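(* Let $L^\star$ have the Fredholm property and be $*$-closed. Assume furthermore that $R_1TR_0\in L^{-\infty}(\mathbf{g})$ whenever $\mathbf{g}=(g_0,g_1)$ is admissible, $R_j\in L^{-\infty}(\mathbf{g}_j)$ ($j=0,1$) are smoothing operators, and $T:H^0(g_0)\to H^0(g_1)$ is a continuous linear operator. Then $T^0(\mathbf{g},P_0,P_1)$ is spectrally invariant for every admissible $\mathbf{g}$ and all projections $P_j\in L^0(\mathbf{g}_j)$; i.e., if $A\in T^0(\mathbf{g},P_0,P_1)$ induces an isomorphism $H^0(g_0,P_0)\to H^0(g_1,P_1)$, then there exists $B\in T^0(\mathbf{g}^{(-1)},P_1,P_0)$ such that $BA=P_0$ and $AB=P_1$.
   Context: Setting. With every "datum" $g$ there is associated a scale of Hilbert spaces $H^s(g)$, $s\in\mathbb{N}_0=\{0,1,2,\dots\}$, with continuous inclusions $H^{s+1}(g)\subset H^s(g)$. $\mathbf{G}$ is a set of "admissible" pairs $\mathbf{g}=(g_0,g_1)$ of data; for such a pair write $\mathbf{g}^{(-1)}=(g_1,g_0)$, $\mathbf{g}_0=(g_0,g_0)$, $\mathbf{g}_1=(g_1,g_1)$; these are also admissible, and if $(g_0,g_1),(g_1,g_2)$ are admissible, so is $(g_0,g_2)$. For each admissible $\mathbf{g}$ and each integer $\mu\le 0$, $L^\mu(\mathbf{g})$ is a vector space of linear operators $A:H^0(g_0)\to H^0(g_1)$ inducing continuous operators $A:H^s(g_0)\to H^{s-\mu}(g_1)$ for all $s\in\mathbb{N}_0$. It is assumed that $L^\mu(\mathbf{g})\subset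 L^\nu(\mathbf{g})$ for $\mu\le\nu$, that composition maps $L^\mu((g_1,g_2))\times L^\nu((g_0,g_1))$ into $L^{\mu+\nu}((g_0,g_2))$, and that the identity $1$ belongs to $L^0((g,g))$ for admissible $(g,g)$. $L^\star$ is the union of all $L^\mu(\mathbf{g})$, and $L^{-\infty}(\mathbf{g})=\bigcap_{\mu\le0}L^\mu(\mathbf{g})$ (smoothing operators). Ellipticity in $L^\star$: $A\in L^0(\mathbf{g})$ is elliptic if there is $B\in L^0(\mathbf{g}^{(-1)})$ with $BA-1\in L^{-\infty}(\mathbf{g}_0)$ and $AB-1\in L^{-\infty}(\mathbf{g}_1)$. $L^\star$ has the Fredholm property if for every admissible $\mathbf{g}$: (a) every $R\in L^{-\infty}(\mathbf{g})$ is compact $H^0(g_0)\to H^0(g_1)$; (b) if $A\in L^0(\mathbf{g})$ is a Fredholm operator $H^0(g_0)\to H^0(g_1)$, then $A$ is elliptic. $L^\star$ is $*$-closed if for every admissible $\mathbf{g}$ and $A\in L^0(\mathbf{g})$ there is $A^*\in L^0(\mathbf{g}^{(-1)})$ such that $A^*:H^0(g_1)\to H^0(g_0)$ is the Hilbert space adjoint of $A:H^0(g_0)\to H^0(g_1)$. Toeplitz subalgebras: for projections $P_j\in L^0(\mathbf{g}_j)$, $P_j^2=P_j$ ($j=0,1$), put $T^\mu(\mathbf{g},P_0,P_1)=\{A\in L^\mu(\mathbf{g}) : (1-P_1)A=0,\ A(1-P_0)=0\}$, and $H^s(g_j,P_j)=P_j(H^s(g_j))$, a closed subspace of $H^s(g_j)$.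 Every $A\in T^\mu(\mathbf{g},P_0,P_1)$ induces continuous operators $H^s(g_0,P_0)\to H^{s-\mu}(g_1,P_1)$. *)

theory Defs
  imports "HOL-Analysis.Analysis"
begin

text \<open>
  The spaces \<open>H\<^sup>s(g)\<close> vary with \<open>s\<close> and \<open>g\<close>, so they are carrier sets, each with its own
  inner product, inside one ambient complex vector space (an arbitrary type with an arbitrary
  scalar multiplication \<open>smul\<close>).  The ambient space carries no topology; any family of Hilbert
  spaces embeds into such a space, for instance into its algebraic direct sum, so nothing is lost.
\<close>

section \<open>Complex Hilbert spaces on a carrier\<close>

record 'v hspace =
  car :: "'v set"
  ip :: "'v \<Rightarrow> 'v \<Rightarrow> complex"

text \<open>The values off the carrier are irrelevant; they are set to 0 because
  \<^locale>\<open>Metric_space\<close> requires symmetry and nonnegativity on the whole type.\<close>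

definition hdist :: "'v::ab_group_add hspace \<Rightarrow> 'v \<Rightarrow> 'v \<Rightarrow> real" where
  "hdist X x y =
    (if x \<in> car X \<and> y \<in> car X then sqrt (Re (ip X (x - y) (x - y))) else 0)"

definition htop :: "'v::ab_group_add hspace \<Rightarrow> 'v topology" where
  "htop X = Metric_space.mtopology (car X) (hdist X)"

locale complex_hilbert = vector_space smul
  for smul :: "complex \<Rightarrow> 'v::ab_group_add \<Rightarrow> 'v" and X :: "'v hspace" +
  assumes subspace_car: "subspace (car X)"
    and ip_commute: "\<lbrakk>x \<in> car X; y \<in> car X\<rbrakk> \<Longrightarrow> ip X x y = cnj (ip X y x)"
    and ip_add_left:
      "\<lbrakk>x \<in> car X; y \<in> car X; z \<in> car X\<rbrakk> \<Longrightarrow> ip X (x + y) z = ip X x z + ip X y z"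
    and ip_scale_left:
      "\<lbrakk>x \<in> car X; y \<in> car X\<rbrakk> \<Longrightarrow> ip X (smul c x) y = c * ip X x y"
    and ip_pos: "\<lbrakk>x \<in> car X; x \<noteq> 0\<rbrakk> \<Longrightarrow> 0 < Re (ip X x x)"
    and complete: "Metric_space.mcomplete (car X) (hdist X)"

text \<open>
  An operator \<open>X \<rightarrow> Y\<close> is a function on the ambient type of which only the values on the carrier
  of \<open>X\<close> matter; accordingly, equality of operators is always equality on the carrier.
\<close>

definition linear_op ::
  "(complex \<Rightarrow> 'v::ab_group_add \<Rightarrow> 'v) \<Rightarrow> 'v hspace \<Rightarrow> 'v hspace \<Rightarrow> ('v \<Rightarrow> 'v) \<Rightarrow> bool" where
  "linear_op smul X Y A \<longleftrightarrow>
    (\<forall>x\<in>car X. A x \<in> car Y) \<and>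
    (\<forall>x\<in>car X. \<forall>y\<in>car X. A (x + y) = A x + A y) \<and>
    (\<forall>c. \<forall>x\<in>car X. A (smul c x) = smul c (A x))"

definition bounded_op ::
  "(complex \<Rightarrow> 'v::ab_group_add \<Rightarrow> 'v) \<Rightarrow> 'v hspace \<Rightarrow> 'v hspace \<Rightarrow> ('v \<Rightarrow> 'v) \<Rightarrow> bool" where
  "bounded_op smul X Y A \<longleftrightarrow>
    linear_op smul X Y A \<and> continuous_map (htop X) (htop Y) A"

definition compact_op ::
  "(complex \<Rightarrow> 'v::ab_group_add \<Rightarrow> 'v) \<Rightarrow> 'v hspace \<Rightarrow> 'v hspace \<Rightarrow> ('v \<Rightarrow> 'v) \<Rightarrow> bool" where
  "compact_op smul X Y A \<longleftrightarrow>
    linear_op smul X Y A \<and>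
    compactin (htop Y) (htop Y closure_of (A ` {x \<in> car X. hdist X 0 x \<le> 1}))"

text \<open>Finite-dimensional kernel and finite-dimensional cokernel \<open>Y / A(X)\<close>; that the range is
  closed is then automatic.  The second existential says that finitely many classes span
  the quotient.\<close>

definition fredholm_op ::
  "(complex \<Rightarrow> 'v::ab_group_add \<Rightarrow> 'v) \<Rightarrow> 'v hspace \<Rightarrow> 'v hspace \<Rightarrow> ('v \<Rightarrow> 'v) \<Rightarrow> bool" where
  "fredholm_op smul X Y A \<longleftrightarrow>
    bounded_op smul X Y A \<and>
    (\<exists>F. finite F \<and> {x \<in> car X. A x = 0} = module.span smul F) \<and>
    (\<exists>F. finite F \<and> F \<subseteq> car Y \<and>
      car Y = {A x + y |x y. x \<in> car X \<and> y \<in> module.span smul F})"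

definition adjoint_op ::
  "'v hspace \<Rightarrow> 'v hspace \<Rightarrow> ('v \<Rightarrow> 'v) \<Rightarrow> ('v \<Rightarrow> 'v) \<Rightarrow> bool" where
  "adjoint_op X Y A A' \<longleftrightarrow>
    (\<forall>y\<in>car Y. A' y \<in> car X) \<and>
    (\<forall>x\<in>car X. \<forall>y\<in>car Y. ip Y (A x) y = ip X x (A' y))"


section \<open>The operator classes\<close>

text \<open>
  \<open>H g s\<close> is \<open>H\<^sup>s(g)\<close>, \<open>G\<close> is the set of admissible pairs, and \<open>L \<mu> (g0, g1)\<close> is
  \<open>L\<^sup>\<mu>((g\<^sub>0,g\<^sub>1))\<close>, constrained only for \<open>\<mu> \<le> 0\<close> and admissible pairs.  The
  assumption \<open>L_cong\<close> is the convention on operators above.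
\<close>

locale operator_classes = vector_space smul
  for smul :: "complex \<Rightarrow> 'v::ab_group_add \<Rightarrow> 'v"
    and H :: "'g \<Rightarrow> nat \<Rightarrow> 'v hspace"
    and G :: "('g \<times> 'g) set"
    and L :: "int \<Rightarrow> 'g \<times> 'g \<Rightarrow> ('v \<Rightarrow> 'v) set" +
  assumes hilbert: "complex_hilbert smul (H g s)"
    and incl: "car (H g (Suc s)) \<subseteq> car (H g s)"
    and incl_continuous: "continuous_map (htop (H g (Suc s))) (htop (H g s)) (\<lambda>x. x)"
    and G_swap: "(g0, g1) \<in> G \<Longrightarrow> (g1, g0) \<in> G"
    and G_left: "(g0, g1) \<in> G \<Longrightarrow> (g0, g0) \<in> G"
    and G_right: "(g0, g1) \<in> G \<Longrightarrow> (g1, g1) \<in> G"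
    and G_trans: "\<lbrakk>(g0, g1) \<in> G; (g1, g2) \<in> G\<rbrakk> \<Longrightarrow> (g0, g2) \<in> G"
    and L_linear:
      "\<lbrakk>(g0, g1) \<in> G; \<mu> \<le> 0; A \<in> L \<mu> (g0, g1)\<rbrakk> \<Longrightarrow> linear_op smul (H g0 0) (H g1 0) A"
    and L_continuous:
      "\<lbrakk>(g0, g1) \<in> G; \<mu> \<le> 0; A \<in> L \<mu> (g0, g1)\<rbrakk> \<Longrightarrow>
        continuous_map (htop (H g0 s)) (htop (H g1 (nat (int s - \<mu>)))) A"
    and L_cong:
      "\<lbrakk>(g0, g1) \<in> G; \<mu> \<le> 0; A \<in> L \<mu> (g0, g1); \<forall>x\<in>car (H g0 0). A' x = A x\<rbrakk> \<Longrightarrow>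
        A' \<in> L \<mu> (g0, g1)"
    and L_zero: "\<lbrakk>(g0, g1) \<in> G; \<mu> \<le> 0\<rbrakk> \<Longrightarrow> (\<lambda>x. 0) \<in> L \<mu> (g0, g1)"
    and L_add:
      "\<lbrakk>(g0, g1) \<in> G; \<mu> \<le> 0; A \<in> L \<mu> (g0, g1); B \<in> L \<mu> (g0, g1)\<rbrakk> \<Longrightarrow>
        (\<lambda>x. A x + B x) \<in> L \<mu> (g0, g1)"
    and L_scale:
      "\<lbrakk>(g0, g1) \<in> G; \<mu> \<le> 0; A \<in> L \<mu> (g0, g1)\<rbrakk> \<Longrightarrow>
        (\<lambda>x. smul c (A x)) \<in> L \<mu> (g0, g1)"
    and L_mono: "\<lbrakk>(g0, g1) \<in> G; \<mu> \<le> \<nu>; \<nu> \<le> 0\<rbrakk> \<Longrightarrow> L \<mu> (g0, g1) \<subseteq> L \<nu> (g0, g1)"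
    and L_comp:
      "\<lbrakk>(g0, g1) \<in> G; (g1, g2) \<in> G; \<mu> \<le> 0; \<nu> \<le> 0; A \<in> L \<mu> (g1, g2); B \<in> L \<nu> (g0, g1)\<rbrakk> \<Longrightarrow>
        A \<circ> B \<in> L (\<mu> + \<nu>) (g0, g2)"
    and L_id: "(g, g) \<in> G \<Longrightarrow> (\<lambda>x. x) \<in> L 0 (g, g)"

definition smoothing ::
  "(int \<Rightarrow> 'g \<times> 'g \<Rightarrow> ('v \<Rightarrow> 'v) set) \<Rightarrow> 'g \<times> 'g \<Rightarrow> ('v \<Rightarrow> 'v) set" where
  "smoothing L g = (\<Inter>\<mu>\<in>{..0}. L \<mu> g)"

definition elliptic ::
  "(int \<Rightarrow> 'g \<times> 'g \<Rightarrow> ('v::ab_group_add \<Rightarrow> 'v) set) \<Rightarrow> 'g \<Rightarrow> 'g \<Rightarrow> ('v \<Rightarrow> 'v) \<Rightarrow> bool" where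
  "elliptic L g0 g1 A \<longleftrightarrow>
    A \<in> L 0 (g0, g1) \<and>
    (\<exists>B\<in>L 0 (g1, g0).
      (\<lambda>x. B (A x) - x) \<in> smoothing L (g0, g0) \<and>
      (\<lambda>x. A (B x) - x) \<in> smoothing L (g1, g1))"

definition fredholm_property ::
  "(complex \<Rightarrow> 'v::ab_group_add \<Rightarrow> 'v) \<Rightarrow> ('g \<Rightarrow> nat \<Rightarrow> 'v hspace) \<Rightarrow> ('g \<times> 'g) set \<Rightarrow>
    (int \<Rightarrow> 'g \<times> 'g \<Rightarrow> ('v \<Rightarrow> 'v) set) \<Rightarrow> bool" where
  "fredholm_property smul H G L \<longleftrightarrow>
    (\<forall>g0 g1. (g0, g1) \<in> G \<longrightarrow>
      (\<forall>R\<in>smoothing L (g0, g1). compact_op smul (H g0 0) (H g1 0) R) \<and>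
      (\<forall>A\<in>L 0 (g0, g1). fredholm_op smul (H g0 0) (H g1 0) A \<longrightarrow> elliptic L g0 g1 A))"

definition star_closed ::
  "('g \<Rightarrow> nat \<Rightarrow> 'v hspace) \<Rightarrow> ('g \<times> 'g) set \<Rightarrow>
    (int \<Rightarrow> 'g \<times> 'g \<Rightarrow> ('v \<Rightarrow> 'v) set) \<Rightarrow> bool" where
  "star_closed H G L \<longleftrightarrow>
    (\<forall>g0 g1. (g0, g1) \<in> G \<longrightarrow>
      (\<forall>A\<in>L 0 (g0, g1). \<exists>A'\<in>L 0 (g1, g0). adjoint_op (H g0 0) (H g1 0) A A'))"


section \<open>Toeplitz subalgebras\<close>

definition is_projection ::
  "('g \<Rightarrow> nat \<Rightarrow> 'v hspace) \<Rightarrow> (int \<Rightarrow> 'g \<times> 'g \<Rightarrow> ('v \<Rightarrow> 'v) set) \<Rightarrow> 'g \<Rightarrow> ('v \<Rightarrow> 'v) \<Rightarrow> bool" where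
  "is_projection H L g P \<longleftrightarrow> P \<in> L 0 (g, g) \<and> (\<forall>x\<in>car (H g 0). P (P x) = P x)"

definition toeplitz ::
  "('g \<Rightarrow> nat \<Rightarrow> 'v::ab_group_add hspace) \<Rightarrow> (int \<Rightarrow> 'g \<times> 'g \<Rightarrow> ('v \<Rightarrow> 'v) set) \<Rightarrow>
    int \<Rightarrow> 'g \<Rightarrow> 'g \<Rightarrow> ('v \<Rightarrow> 'v) \<Rightarrow> ('v \<Rightarrow> 'v) \<Rightarrow> ('v \<Rightarrow> 'v) set" where
  "toeplitz H L \<mu> g0 g1 P0 P1 =
    {A \<in> L \<mu> (g0, g1). \<forall>x\<in>car (H g0 0). A x - P1 (A x) = 0 \<and> A (x - P0 x) = 0}"

text \<open>\<open>H\<^sup>s(g,P) = P(H\<^sup>s(g))\<close> with the topology of \<open>H\<^sup>s(g)\<close>.\<close>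

definition range_top ::
  "('g \<Rightarrow> nat \<Rightarrow> 'v::ab_group_add hspace) \<Rightarrow> nat \<Rightarrow> 'g \<Rightarrow> ('v \<Rightarrow> 'v) \<Rightarrow> 'v topology" where
  "range_top H s g P = subtopology (htop (H g s)) (P ` car (H g s))"

text \<open>Isomorphisms are linear homeomorphisms; linearity is part of membership in
  \<^const>\<open>toeplitz\<close>.\<close>

definition spectrally_invariant ::
  "('g \<Rightarrow> nat \<Rightarrow> 'v::ab_group_add hspace) \<Rightarrow> (int \<Rightarrow> 'g \<times> 'g \<Rightarrow> ('v \<Rightarrow> 'v) set) \<Rightarrow>
    'g \<Rightarrow> 'g \<Rightarrow> ('v \<Rightarrow> 'v) \<Rightarrow> ('v \<Rightarrow> 'v) \<Rightarrow> bool" where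
  "spectrally_invariant H L g0 g1 P0 P1 \<longleftrightarrow>
    (\<forall>A\<in>toeplitz H L 0 g0 g1 P0 P1.
      homeomorphic_map (range_top H 0 g0 P0) (range_top H 0 g1 P1) A \<longrightarrow>
      (\<exists>B\<in>toeplitz H L 0 g1 g0 P1 P0.
        (\<forall>x\<in>car (H g0 0). B (A x) = P0 x) \<and> (\<forall>y\<in>car (H g1 0). A (B y) = P1 y)))"

end

theory Submission
  imports Defs
begin

text \<open>
  Put \<open>E = 1 - P\<^sub>0\<close> and \<open>S = A\<^sup>*A + E\<^sup>*E\<close>.  Since \<open>A\<close> is bounded below on the range of \<open>P\<^sub>0\<close>, the
  form \<open>\<langle>Sx, x\<rangle> = \<parallel>Ax\<parallel>\<^sup>2 + \<parallel>Ex\<parallel>\<^sup>2\<close> is coercive, so \<open>S\<close> is bijective, hence Fredholm, hence elliptic.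
  If \<open>C\<close> is a parametrix with smoothing remainders \<open>R = CS - 1\<close> and \<open>R' = SC - 1\<close>, then
  \<open>S\<^sup>-\<^sup>1 = R S\<^sup>-\<^sup>1 R' + 2C - CSC\<close> lies in \<open>L\<^sup>0\<close>, because sandwiching \<open>S\<^sup>-\<^sup>1\<close> between smoothing
  operators is smoothing.  The inverse of \<open>A\<close> is \<open>P\<^sub>0 S\<^sup>-\<^sup>1 A\<^sup>* P\<^sub>1\<close>, since \<open>S\<close> and \<open>A\<^sup>*A\<close> agree on
  the range of \<open>P\<^sub>0\<close>.
\<close>

section \<open>Hilbert spaces on a carrier\<close>

definition hnorm :: "'v hspace \<Rightarrow> 'v \<Rightarrow> real" where
  "hnorm X x = sqrt (Re (ip X x x))"

context complex_hilbert
begin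

section \<open>Inner product calculus and the induced norm\<close>

lemma car_zero: "0 \<in> car X"
  using subspace_car by (rule subspace_0)

lemma car_add: "\<lbrakk>x \<in> car X; y \<in> car X\<rbrakk> \<Longrightarrow> x + y \<in> car X"
  using subspace_car by (rule subspace_add)

lemma car_diff: "\<lbrakk>x \<in> car X; y \<in> car X\<rbrakk> \<Longrightarrow> x - y \<in> car X"
  using subspace_car by (rule subspace_diff)

lemma car_scale: "x \<in> car X \<Longrightarrow> smul c x \<in> car X"
  using subspace_car by (rule subspace_scale)

text \<open>Norms and coercivity involve only real parts, and these form a symmetric real bilinear
  form, so conjugates need not be tracked in what follows.\<close>

lemma Re_ip_commute: "\<lbrakk>x \<in> car X; y \<in> car X\<rbrakk> \<Longrightarrow> Re (ip X x y) = Re (ip X y x)"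
  using ip_commute[of x y] by simp

lemma ip_zero_left: "y \<in> car X \<Longrightarrow> ip X 0 y = 0"
  using ip_scale_left[OF car_zero, of y 0] by simp

lemma ip_diff_left:
  assumes "x \<in> car X" "y \<in> car X" "z \<in> car X"
  shows "ip X (x - y) z = ip X x z - ip X y z"
  using ip_add_left[of "x - y" y z] assms car_diff by simp

lemma Re_ip_diff_right:
  assumes "x \<in> car X" "y \<in> car X" "z \<in> car X"
  shows "Re (ip X z (x - y)) = Re (ip X z x) - Re (ip X z y)"
  using assms by (simp add: Re_ip_commute[of z] car_diff ip_diff_left)

lemma Re_ip_add_right:
  assumes "x \<in> car X" "y \<in> car X" "z \<in> car X"
  shows "Re (ip X z (x + y)) = Re (ip X z x) + Re (ip X z y)"
  using assms by (simp add: Re_ip_commute[of z] car_add ip_add_left)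

lemma Re_ip_scale_left:
  assumes "x \<in> car X" "y \<in> car X"
  shows "Re (ip X (smul (of_real t) x) y) = t * Re (ip X x y)"
  using assms by (simp add: ip_scale_left)

lemma Re_ip_scale_right:
  assumes "x \<in> car X" "y \<in> car X"
  shows "Re (ip X x (smul (of_real t) y)) = t * Re (ip X x y)"
  using assms by (simp add: Re_ip_commute[of x] car_scale Re_ip_scale_left)

lemma Re_ip_self_nonneg: "x \<in> car X \<Longrightarrow> 0 \<le> Re (ip X x x)"
  using ip_pos[of x] ip_zero_left[OF car_zero] by (cases "x = 0") auto

lemma hnorm_nonneg: "x \<in> car X \<Longrightarrow> 0 \<le> hnorm X x"
  by (simp add: hnorm_def Re_ip_self_nonneg)

lemma hnorm_power2: "x \<in> car X \<Longrightarrow> (hnorm X x)\<^sup>2 = Re (ip X x x)"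
  by (simp add: hnorm_def Re_ip_self_nonneg)

lemma hnorm_zero: "hnorm X 0 = 0"
  by (simp add: hnorm_def ip_zero_left car_zero)

lemma hnorm_pos: "\<lbrakk>x \<in> car X; x \<noteq> 0\<rbrakk> \<Longrightarrow> 0 < hnorm X x"
  by (simp add: hnorm_def ip_pos)

lemma hnorm_scale: "x \<in> car X \<Longrightarrow> hnorm X (smul (of_real t) x) = \<bar>t\<bar> * hnorm X x"
  by (simp add: hnorm_def Re_ip_scale_left Re_ip_scale_right car_scale real_sqrt_mult
      flip: mult.assoc)

lemma hnorm_minus: "x \<in> car X \<Longrightarrow> hnorm X (- x) = hnorm X x"
  using hnorm_scale[of x "-1"] by simp

lemma hnorm_diff_power2:
  assumes "x \<in> car X" "y \<in> car X"
  shows "(hnorm X (x - y))\<^sup>2 = (hnorm X x)\<^sup>2 - 2 * Re (ip X x y) + (hnorm X y)\<^sup>2"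
  using assms
  by (simp add: hnorm_power2 car_diff ip_diff_left Re_ip_diff_right Re_ip_commute[of y x])

text \<open>Cauchy-Schwarz for the real part: subtracting from \<open>x\<close> its component along
  \<open>y\<close> leaves a vector whose squared norm is nonnegative.\<close>

lemma Re_ip_le_hnorm:
  assumes x: "x \<in> car X" and y: "y \<in> car X"
  shows "Re (ip X x y) \<le> hnorm X x * hnorm X y"
proof (cases "y = 0")
  case True
  then show ?thesis
    using x by (simp add: Re_ip_commute[of x 0] car_zero ip_zero_left hnorm_zero)
next
  case False
  define n where "n = hnorm X y"
  define r where "r = Re (ip X x y)"
  have n: "n > 0" using hnorm_pos[OF y False] by (simp add: n_def)
  \<comment> \<open>The coefficient \<open>r / n^2\<close> minimises the distance from
    \<open>x\<close> to the real multiples of \<open>y\<close>.\<close>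
  have "0 \<le> (hnorm X (x - smul (of_real (r / n\<^sup>2)) y))\<^sup>2" by simp
  also have "\<dots> = (hnorm X x)\<^sup>2 - 2 * (r / n\<^sup>2 * r) + (r / n\<^sup>2)\<^sup>2 * n\<^sup>2"
    unfolding hnorm_diff_power2[OF x car_scale[OF y]] hnorm_scale[OF y] Re_ip_scale_right[OF x y]
    by (simp add: r_def n_def power_mult_distrib del: abs_divide)
  also have "\<dots> = (hnorm X x)\<^sup>2 - r\<^sup>2 / n\<^sup>2"
    using n by (simp add: field_simps power2_eq_square)
  finally have "r\<^sup>2 \<le> (hnorm X x * n)\<^sup>2"
    using n by (simp add: field_simps)
  then show ?thesis
    using power2_le_imp_le[of r "hnorm X x * n"] n hnorm_nonneg[OF x]
    by (simp add: r_def n_def)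
qed

lemma hnorm_triangle:
  assumes x: "x \<in> car X" and y: "y \<in> car X"
  shows "hnorm X (x + y) \<le> hnorm X x + hnorm X y"
proof (rule power2_le_imp_le)
  have "(hnorm X (x + y))\<^sup>2 = (hnorm X x)\<^sup>2 + 2 * Re (ip X x y) + (hnorm X y)\<^sup>2"
    using x y by (simp add: hnorm_power2 car_add ip_add_left Re_ip_add_right Re_ip_commute[of y x])
  then show "(hnorm X (x + y))\<^sup>2 \<le> (hnorm X x + hnorm X y)\<^sup>2"
    using Re_ip_le_hnorm[OF x y] by (simp add: power2_sum)
qed (simp add: hnorm_nonneg x y)

section \<open>The metric of the norm\<close>

lemma hdist_hnorm: "\<lbrakk>x \<in> car X; y \<in> car X\<rbrakk> \<Longrightarrow> hdist X x y = hnorm X (x - y)"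
  by (simp add: hdist_def hnorm_def)

lemma Metric_space_hdist: "Metric_space (car X) (hdist X)"
proof
  fix x y z
  show "0 \<le> hdist X x y"
    by (simp add: hdist_def Re_ip_self_nonneg car_diff)
  show "hdist X x y = hdist X y x"
  proof (cases "x \<in> car X \<and> y \<in> car X")
    case True
    then show ?thesis using hnorm_minus[of "x - y"] by (simp add: hdist_hnorm car_diff)
  qed (auto simp: hdist_def)
  assume x: "x \<in> car X" and y: "y \<in> car X"
  show "hdist X x y = 0 \<longleftrightarrow> x = y"
    using hnorm_pos[of "x - y"] x y by (cases "x = y") (auto simp: hdist_hnorm car_diff hnorm_zero)
  assume z: "z \<in> car X"
  show "hdist X x z \<le> hdist X x y + hdist X y z"
    using hnorm_triangle[of "x - y" "y - z"] x y z by (simp add: hdist_hnorm car_diff)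
qed

end

text \<open>Makes the theory of metric spaces available under the prefix \<open>M\<close>, stated
  for \<open>htop X\<close>, the topology in which continuity of operators is defined.\<close>

sublocale complex_hilbert \<subseteq> M: Metric_space "car X" "hdist X"
  rewrites "M.mtopology = htop X"
  by (rule Metric_space_hdist) (simp add: htop_def)

context complex_hilbert
begin

section \<open>Linear operators and coercive equations\<close>

lemma linear_op_zero: "linear_op smul X Y A \<Longrightarrow> A 0 = 0"
  unfolding linear_op_def using car_zero
  by (metis add.right_neutral add_left_cancel)

lemma linear_op_diff:
  assumes "linear_op smul X Y A" "x \<in> car X" "y \<in> car X"
  shows "A (x - y) = A x - A y"
proof -
  have "A ((x - y) + y) = A (x - y) + A y"
    using assms car_diff unfolding linear_op_def by blast
  then show ?thesis by simp
qed

lemma linear_op_range_scale: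
  assumes "linear_op smul X Y A" "v \<in> A ` car X"
  shows "smul a v \<in> A ` car X"
proof -
  obtain x where "x \<in> car X" "v = A x" using assms(2) by blast
  then have "smul a v = A (smul a x)" "smul a x \<in> car X"
    using assms(1) by (auto simp: linear_op_def car_scale)
  then show ?thesis by blast
qed

text \<open>Lax--Milgram: for small \<open>t > 0\<close> the map \<open>x \<mapsto> x - t (S x - y)\<close> is a contraction.\<close>

lemma coercive_surj:
  assumes S: "linear_op smul X X S" and c: "c > 0" and y: "y \<in> car X"
    and bdd: "\<And>x. x \<in> car X \<Longrightarrow> hnorm X (S x) \<le> C * hnorm X x"
    and coer: "\<And>x. x \<in> car X \<Longrightarrow> c * (hnorm X x)\<^sup>2 \<le> Re (ip X (S x) x)"
  obtains x where "x \<in> car X" "S x = y"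
proof -
  \<comment> \<open>Since the squared norm of \<open>S x\<close> is at most \<open>D\<close> times
    that of \<open>x\<close>, the squared norm of \<open>x - t S x\<close> is at most
    \<open>1 - 2 t c + t^2 D\<close> times that of \<open>x\<close>. This factor is smallest at
    \<open>t = c / D\<close>, where it equals \<open>1 - c^2 / D\<close>. The summands
    \<open>1\<close> and \<open>c^2\<close> in \<open>D\<close> keep it strictly between 0 and
    1.\<close>
  define D where "D = 1 + C\<^sup>2 + c\<^sup>2"
  define t where "t = c / D"
  define k where "k = sqrt (1 - c\<^sup>2 / D)"
  have D: "D > 0" unfolding D_def by (simp add: add_pos_nonneg)
  have t: "t > 0" using c D by (simp add: t_def)
  have cD: "0 < c\<^sup>2 / D" "c\<^sup>2 / D < 1"
    using c D by (auto simp: D_def add_pos_nonneg field_simps)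
  have Sx: "S x \<in> car X" if "x \<in> car X" for x
    using S that by (simp add: linear_op_def)
  define f where "f x = x - smul (of_real t) (S x - y)" for x
  have con: "hnorm X (x - smul (of_real t) (S x)) \<le> k * hnorm X x" if x: "x \<in> car X" for x
  proof (rule power2_le_imp_le)
    let ?n = "(hnorm X x)\<^sup>2"
    have "(hnorm X (S x))\<^sup>2 \<le> (C * hnorm X x)\<^sup>2"
      using bdd[OF x] hnorm_nonneg[OF Sx[OF x]] by (intro power_mono) auto
    also have "\<dots> \<le> D * ?n"
      by (simp add: D_def power_mult_distrib mult_right_mono)
    finally have SD: "(hnorm X (S x))\<^sup>2 \<le> D * ?n" .
    have "(hnorm X (x - smul (of_real t) (S x)))\<^sup>2
        = ?n - 2 * (t * Re (ip X (S x) x)) + t\<^sup>2 * (hnorm X (S x))\<^sup>2"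
      using x Sx[OF x]
      by (simp add: hnorm_diff_power2 car_scale Re_ip_scale_right hnorm_scale power_mult_distrib
          Re_ip_commute[of x])
    also have "\<dots> \<le> ?n - 2 * (t * (c * ?n)) + t\<^sup>2 * (D * ?n)"
      using mult_left_mono[OF coer[OF x] less_imp_le[OF t]]
        mult_left_mono[OF SD zero_le_power2[of t]] by linarith
    also have "\<dots> = (1 - c\<^sup>2 / D) * ?n"
      using D by (simp add: t_def field_simps power2_eq_square)
    also have "\<dots> = (k * hnorm X x)\<^sup>2"
      using cD by (simp add: k_def power_mult_distrib)
    finally show "(hnorm X (x - smul (of_real t) (S x)))\<^sup>2 \<le> (k * hnorm X x)\<^sup>2" .
  next
    show "0 \<le> k * hnorm X x"
      using cD hnorm_nonneg[OF x] by (simp add: k_def)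
  qed
  have fX: "f x \<in> car X" if "x \<in> car X" for x
    unfolding f_def using that y by (intro car_diff car_scale Sx)
  obtain x where x: "x \<in> car X" "f x = x"
  proof (rule M.Banach_fixedpoint_thm[of f k])
    show "M.mcomplete" by (rule complete)
    show "car X \<noteq> {}" using car_zero by blast
    show "f \<in> car X \<rightarrow> car X" using fX by blast
    show "k < 1" using cD by (simp add: k_def)
    fix x z assume xz: "x \<in> car X" "z \<in> car X"
    \<comment> \<open>The affine term \<open>y\<close> cancels, so the estimate \<open>con\<close>
      for the linear part gives the contraction.\<close>
    have "f x - f z = (x - z) - smul (of_real t) (S (x - z))"
      unfolding linear_op_diff[OF S xz] f_def
      by (simp add: scale_right_diff_distrib algebra_simps)
    then show "hdist X (f x) (f z) \<le> k * hdist X x z"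
      using con[OF car_diff[OF xz]] xz fX by (simp add: hdist_hnorm)
  qed
  have "smul (of_real t) (S x - y) = 0"
    using x(2) unfolding f_def by (metis diff_0_right diff_left_imp_eq)
  then have "S x = y" using t by simp
  with x(1) show thesis by (rule that)
qed

end

text \<open>Continuity at 0 sends a small ball into the unit ball, and rescaling spreads this to all
  of \<open>V\<close>. The form with a subset \<open>V\<close> and real homogeneity serves both
  operators on a full carrier and the inverse of \<open>A\<close> on the range of
  \<open>P1\<close>.\<close>

lemma homogeneous_continuous_bound:
  assumes X: "complex_hilbert smul X" and Y: "complex_hilbert smul Y"
    and V: "V \<subseteq> car X" "0 \<in> V" "\<And>t x. x \<in> V \<Longrightarrow> smul (complex_of_real t) x \<in> V"
    and hom: "\<And>t x. x \<in> V \<Longrightarrow> f (smul (complex_of_real t) x) = smul (complex_of_real t) (f x)"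
    and cont: "continuous_map (subtopology (htop X) V) (htop Y) f"
  obtains C where "\<And>x. x \<in> V \<Longrightarrow> hnorm Y (f x) \<le> C * hnorm X x"
proof -
  interpret X: complex_hilbert smul X by fact
  interpret Y: complex_hilbert smul Y by fact
  \<comment> \<open>Identifies the subspace topology with a metric topology, so that continuity
    becomes an epsilon-delta statement.\<close>
  interpret sub: Submetric "car X" "hdist X" V
    by unfold_locales (use V in auto)
  have "subtopology (htop X) V = Metric_space.mtopology V (hdist X)"
    using sub.mtopology_submetric by (simp add: htop_def)
  with cont have "continuous_map sub.sub.mtopology (Metric_space.mtopology (car Y) (hdist Y)) f"
    by (simp add: htop_def)
  then have fV: "f ` V \<subseteq> car Y"
    and eps: "\<And>a e. \<lbrakk>a \<in> V; e > 0\<rbrakk> \<Longrightarrow>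
      \<exists>\<delta>>0. \<forall>x. x \<in> V \<and> hdist X a x < \<delta> \<longrightarrow> hdist Y (f a) (f x) < e"
    unfolding sub.sub.metric_continuous_map[OF Y.Metric_space_hdist] by auto
  have f0: "f 0 = 0" using hom[OF V(2), of 0] by simp
  obtain d where d: "d > 0" "\<And>x. x \<in> V \<Longrightarrow> hdist X 0 x < d \<Longrightarrow> hdist Y 0 (f x) < 1"
    using eps[OF V(2), of 1] f0 by auto
  have "hnorm Y (f x) \<le> (2 / d) * hnorm X x" if x: "x \<in> V" for x
  proof (cases "x = 0")
    case True
    then show ?thesis by (simp add: f0 X.hnorm_zero Y.hnorm_zero)
  next
    case False
    have xX: "x \<in> car X" and fx: "f x \<in> car Y" using x V(1) fV by auto
    have n: "hnorm X x > 0" using X.hnorm_pos[OF xX False] .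
    \<comment> \<open>Scales \<open>x\<close> to norm \<open>d / 2\<close>, strictly inside the ball
      of radius \<open>d\<close>.\<close>
    define t where "t = d / (2 * hnorm X x)"
    have t: "t > 0" using n d by (simp add: t_def)
    let ?z = "smul (complex_of_real t) x"
    have "hdist X 0 ?z = t * hnorm X x"
      using t xX by (simp add: X.hdist_hnorm X.car_zero X.car_scale X.hnorm_minus X.hnorm_scale)
    also have "\<dots> < d" using n d by (simp add: t_def)
    finally have "hdist Y 0 (f ?z) < 1" using d(2) V(3) x by blast
    then have "t * hnorm Y (f x) < 1"
      using t fx x
      by (simp add: hom Y.hdist_hnorm Y.car_zero Y.car_scale Y.hnorm_minus Y.hnorm_scale)
    then show ?thesis
      using n d by (simp add: t_def field_simps)
  qed
  then show thesis by (rule that)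
qed

lemma bounded_op_bound:
  assumes X: "complex_hilbert smul X" and Y: "complex_hilbert smul Y" and "bounded_op smul X Y A"
  obtains C where "\<And>x. x \<in> car X \<Longrightarrow> hnorm Y (A x) \<le> C * hnorm X x"
proof -
  interpret X: complex_hilbert smul X by fact
  have "subtopology (htop X) (car X) = htop X"
    using X.M.subtopology_mspace by simp
  then show thesis
    using homogeneous_continuous_bound[OF X Y, of "car X" A] assms(3) that X.car_zero X.car_scale
    unfolding bounded_op_def linear_op_def by auto
qed

text \<open>Linearity turns the norm bound into a Lipschitz estimate.\<close>

lemma bounded_opI:
  assumes X: "complex_hilbert smul X" and Y: "complex_hilbert smul Y"
    and A: "linear_op smul X Y A"
    and bdd: "\<And>x. x \<in> car X \<Longrightarrow> hnorm Y (A x) \<le> C * hnorm X x"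
  shows "bounded_op smul X Y A"
  unfolding bounded_op_def
proof
  interpret X: complex_hilbert smul X by fact
  interpret Y: complex_hilbert smul Y by fact
  have AY: "A x \<in> car Y" if "x \<in> car X" for x using A that by (simp add: linear_op_def)
  have "hdist Y (A x) (A z) \<le> C * hdist X x z" if "x \<in> car X" "z \<in> car X" for x z
    using bdd[OF X.car_diff[OF that]] X.linear_op_diff[OF A that] that AY
    by (simp add: X.hdist_hnorm Y.hdist_hnorm)
  then have "Lipschitz_continuous_map (metric (car X, hdist X)) (metric (car Y, hdist Y)) A"
    using AY unfolding Lipschitz_continuous_map_def by auto
  then show "continuous_map (htop X) (htop Y) A"
    using Lipschitz_continuous_imp_continuous_map
    by (fastforce simp: X.M.mtopology_of Y.M.mtopology_of)
qed (rule A)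


section \<open>Inversion in the operator classes\<close>

context operator_classes
begin

lemma L_bounded:
  assumes "(g0, g1) \<in> G" "A \<in> L 0 (g0, g1)"
  shows "bounded_op smul (H g0 0) (H g1 0) A"
  using L_linear[of g0 g1 0 A] L_continuous[of g0 g1 0 A 0] assms by (simp add: bounded_op_def)

lemma L_car:
  assumes "(g0, g1) \<in> G" "A \<in> L 0 (g0, g1)" "x \<in> car (H g0 0)"
  shows "A x \<in> car (H g1 0)"
  using L_linear[of g0 g1 0 A] assms by (simp add: linear_op_def)

lemma L_comp0:
  assumes "(g0, g1) \<in> G" "(g1, g2) \<in> G" "A \<in> L 0 (g1, g2)" "B \<in> L 0 (g0, g1)"
  shows "(\<lambda>x. A (B x)) \<in> L 0 (g0, g2)"
  using L_comp[of g0 g1 g2 0 0 A B] assms by (simp add: comp_def)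

lemma L_diff:
  assumes "(g0, g1) \<in> G" "A \<in> L 0 (g0, g1)" "B \<in> L 0 (g0, g1)"
  shows "(\<lambda>x. A x - B x) \<in> L 0 (g0, g1)"
proof -
  have "(\<lambda>x. A x + smul (- 1) (B x)) \<in> L 0 (g0, g1)"
    using assms by (intro L_add L_scale) auto
  then show ?thesis by simp
qed

text \<open>Coercivity yields injectivity with a lower bound, and surjectivity by Lax-Milgram, hence
  a bounded inverse on the Hilbert space. The parametrix identity then places this inverse in
  \<open>L 0 (g, g)\<close>.\<close>

lemma coercive_inverse:
  assumes fp: "fredholm_property smul H G L"
    and sandwich: "\<And>R0 R1 T. \<lbrakk>R0 \<in> smoothing L (g, g); R1 \<in> smoothing L (g, g);
        bounded_op smul (H g 0) (H g 0) T\<rbrakk> \<Longrightarrow> R1 \<circ> T \<circ> R0 \<in> smoothing L (g, g)"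
    and g: "(g, g) \<in> G" and S: "S \<in> L 0 (g, g)" and c: "c > 0"
    and coer: "\<And>x. x \<in> car (H g 0) \<Longrightarrow> c * (hnorm (H g 0) x)\<^sup>2 \<le> Re (ip (H g 0) (S x) x)"
  obtains T where "T \<in> L 0 (g, g)"
    "\<And>x. x \<in> car (H g 0) \<Longrightarrow> T (S x) = x" "\<And>x. x \<in> car (H g 0) \<Longrightarrow> S (T x) = x"
proof -
  let ?X = "H g 0"
  interpret X: complex_hilbert smul ?X by (rule hilbert)
  have Sb: "bounded_op smul ?X ?X S" using L_bounded[OF g S] .
  then have Sl: "linear_op smul ?X ?X S" by (simp add: bounded_op_def)
  have SX: "S x \<in> car ?X" if "x \<in> car ?X" for x using L_car[OF g S that] .
  obtain C where C: "\<And>x. x \<in> car ?X \<Longrightarrow> hnorm ?X (S x) \<le> C * hnorm ?X x"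
    using bounded_op_bound[OF hilbert hilbert Sb] by blast
  have lower: "c * hnorm ?X x \<le> hnorm ?X (S x)" if x: "x \<in> car ?X" for x
  proof (cases "x = 0")
    case True
    then show ?thesis using X.hnorm_nonneg[OF SX[OF x]] by (simp add: X.hnorm_zero)
  next
    case False
    \<comment> \<open>Coercivity combined with Cauchy-Schwarz; one factor \<open>hnorm ?X x\<close>
      is then cancelled.\<close>
    have "hnorm ?X x * (c * hnorm ?X x) \<le> hnorm ?X x * hnorm ?X (S x)"
      using order_trans[OF coer[OF x] X.Re_ip_le_hnorm[OF SX[OF x] x]]
      by (simp add: power2_eq_square mult_ac)
    then show ?thesis using X.hnorm_pos[OF x False] by simp
  qed
  have ker: "x = 0" if "x \<in> car ?X" "S x = 0" for x
    using lower[OF that(1)] X.hnorm_pos[OF that(1)] c that(2)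
    by (auto simp: X.hnorm_zero mult_le_0_iff)
  have surj: "\<exists>x. x \<in> car ?X \<and> S x = y" if "y \<in> car ?X" for y
    using X.coercive_surj[OF Sl c that C coer] by blast
  have inj: "x = z" if "x \<in> car ?X" "z \<in> car ?X" "S x = S z" for x z
    using ker[of "x - z"] X.linear_op_diff[OF Sl that(1,2)] X.car_diff that by simp
  define T where "T y = (SOME x. x \<in> car ?X \<and> S x = y)" for y
  have T: "T y \<in> car ?X" "S (T y) = y" if "y \<in> car ?X" for y
    using someI_ex[OF surj[OF that]] by (auto simp: T_def)
  have TS: "T (S x) = x" if "x \<in> car ?X" for x
    using inj T SX that by blast
  have Tl: "linear_op smul ?X ?X T"
    unfolding linear_op_def
  proof (intro conjI ballI allI)
    fix x y assume x: "x \<in> car ?X" and y: "y \<in> car ?X"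
    \<comment> \<open>Linearity of the pointwise chosen \<open>T\<close> follows by applying
      \<open>S\<close> to the candidate value and then undoing \<open>S\<close> with
      \<open>TS\<close>.\<close>
    have "S (T x + T y) = x + y"
      using Sl T[OF x] T[OF y] by (simp add: linear_op_def)
    then show "T (x + y) = T x + T y"
      using TS[OF X.car_add[OF T(1)[OF x] T(1)[OF y]]] by simp
  next
    fix a x assume x: "x \<in> car ?X"
    have "S (smul a (T x)) = smul a x"
      using Sl T[OF x] by (simp add: linear_op_def)
    then show "T (smul a x) = smul a (T x)"
      using TS[OF X.car_scale[OF T(1)[OF x], of a]] by simp
  qed (rule T)
  have Tb: "bounded_op smul ?X ?X T"
  proof (rule bounded_opI[OF hilbert hilbert Tl, of "1 / c"])
    show "hnorm ?X (T x) \<le> 1 / c * hnorm ?X x" if x: "x \<in> car ?X" for x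
      using lower[OF T(1)[OF x]] T(2)[OF x] c by (simp add: field_simps)
  qed
  have "fredholm_op smul ?X ?X S"
    unfolding fredholm_op_def
  \<comment> \<open>As \<open>S\<close> is bijective, the empty set spans both kernel and
    cokernel.\<close>
  proof (intro conjI exI[of _ "{}"])
    show "{x \<in> car ?X. S x = 0} = span {}"
      using ker X.linear_op_zero[OF Sl] X.car_zero by auto
    show "car ?X = {S x + y |x y. x \<in> car ?X \<and> y \<in> span {}}"
      using surj SX by fastforce
  qed (auto intro: Sb)
  then have "elliptic L g g S"
    using fp g S by (auto simp: fredholm_property_def)
  \<comment> \<open>\<open>B\<close> is the parametrix, called C in the overview; here
    \<open>C\<close> is the norm bound of \<open>S\<close>.\<close>
  then obtain B where B: "B \<in> L 0 (g, g)"
    and R: "(\<lambda>x. B (S x) - x) \<in> smoothing L (g, g)" (is "?R \<in> _")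
    and R': "(\<lambda>x. S (B x) - x) \<in> smoothing L (g, g)" (is "?R' \<in> _")
    unfolding elliptic_def by blast
  have BX: "B x \<in> car ?X" if "x \<in> car ?X" for x using L_car[OF g B that] .
  have "?R \<circ> T \<circ> ?R' \<in> L 0 (g, g)"
    using sandwich[OF R' R Tb] by (simp add: smoothing_def)
  then have sum: "(\<lambda>x. (?R \<circ> T \<circ> ?R') x + (B x + B x - B (S (B x)))) \<in> L 0 (g, g)"
    using L_add[OF g _ _ L_diff[OF g L_add[OF g _ B B] L_comp0[OF g g B L_comp0[OF g g S B]]]]
    by blast
  \<comment> \<open>With \<open>R = BS - 1\<close> and \<open>R' = SB - 1\<close>, one has
    \<open>T R' = B - T\<close>, and applying \<open>R\<close> gives
    \<open>R T R' = BSB - 2B + T\<close>.\<close>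
  have "T x = (?R \<circ> T \<circ> ?R') x + (B x + B x - B (S (B x)))" if x: "x \<in> car ?X" for x
  proof -
    have "T (?R' x) = B x - T x"
      using X.linear_op_diff[OF Tl SX[OF BX[OF x]] x] TS[OF BX[OF x]] by simp
    moreover have "S (B x - T x) = S (B x) - x"
      using X.linear_op_diff[OF Sl BX[OF x] T(1)[OF x]] T(2)[OF x] by simp
    moreover have "B (S (B x) - x) = B (S (B x)) - B x"
      using X.linear_op_diff[OF L_linear[OF g _ B] SX[OF BX[OF x]] x] by simp
    ultimately show ?thesis by simp
  qed
  \<comment> \<open>The choice operator leaves \<open>T\<close> arbitrary off the carrier;
    \<open>L_cong\<close> makes agreement on the carrier sufficient.\<close>
  then have "T \<in> L 0 (g, g)"
    using L_cong[OF g _ sum] by blast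
  then show thesis using TS T(2) by (rule that)
qed

text \<open>The estimate is the continuity of the inverse homeomorphism from the range of
  \<open>P1\<close> to that of \<open>P0\<close>, made quantitative by
  \<open>homogeneous_continuous_bound\<close>.\<close>

lemma homeomorphic_lower_bound:
  assumes g: "(g0, g1) \<in> G" and A: "A \<in> L 0 (g0, g1)"
    and P0: "is_projection H L g0 P0" and P1: "is_projection H L g1 P1"
    and homeo: "homeomorphic_map (range_top H 0 g0 P0) (range_top H 0 g1 P1) A"
  obtains K where
    "\<And>x. x \<in> car (H g0 0) \<Longrightarrow> hnorm (H g0 0) (P0 x) \<le> K * hnorm (H g1 0) (A (P0 x))"
    "A ` P0 ` car (H g0 0) = P1 ` car (H g1 0)"
proof -
  let ?X = "H g0 0" and ?Y = "H g1 0"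
  interpret X: complex_hilbert smul ?X by (rule hilbert)
  interpret Y: complex_hilbert smul ?Y by (rule hilbert)
  let ?V = "P0 ` car ?X" and ?W = "P1 ` car ?Y"
  have g00: "(g0, g0) \<in> G" and g11: "(g1, g1) \<in> G"
    using G_left[OF g] G_right[OF g] .
  have P0L: "P0 \<in> L 0 (g0, g0)" and P1L: "P1 \<in> L 0 (g1, g1)"
    using P0 P1 by (auto simp: is_projection_def)
  have lin: "linear_op smul ?X ?X P0" "linear_op smul ?Y ?Y P1" "linear_op smul ?X ?Y A"
    using L_linear[OF g00 _ P0L] L_linear[OF g11 _ P1L] L_linear[OF g _ A] by auto
  have VX: "?V \<subseteq> car ?X" and WY: "?W \<subseteq> car ?Y"
    using lin by (auto simp: linear_op_def)
  note Vs = X.linear_op_range_scale[OF lin(1)] and Ws = Y.linear_op_range_scale[OF lin(2)]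
  have top: "topspace (range_top H 0 g0 P0) = ?V" "topspace (range_top H 0 g1 P1) = ?W"
    using VX WY X.M.topspace_mtopology Y.M.topspace_mtopology by (auto simp: range_top_def)
  obtain f where f: "continuous_map (range_top H 0 g1 P1) (range_top H 0 g0 P0) f"
    and fA: "\<And>v. v \<in> ?V \<Longrightarrow> f (A v) = v"
    using homeo unfolding homeomorphic_map_maps homeomorphic_maps_def top by blast
  have AV: "A ` ?V = ?W"
    using homeomorphic_imp_surjective_map[OF homeo] by (simp add: top)
  have "0 \<in> ?W"
    using Y.linear_op_zero[OF lin(2)] Y.car_zero by (metis image_eqI)
  \<comment> \<open>The inverse is given merely as a continuous map; its homogeneity is inherited
    from \<open>A\<close> by writing \<open>w = A v\<close>.\<close>
  moreover have "f (smul a w) = smul a (f w)" if w: "w \<in> ?W" for a w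
  proof -
    obtain v where v: "v \<in> ?V" "w = A v" using w AV by blast
    then have "smul a w = A (smul a v)"
      using lin(3) VX by (auto simp: linear_op_def)
    then show ?thesis using fA v Vs by simp
  qed
  moreover have "continuous_map (subtopology (htop ?Y) ?W) (htop ?X) f"
    using f by (simp add: range_top_def continuous_map_in_subtopology)
  ultimately obtain K where K: "\<And>w. w \<in> ?W \<Longrightarrow> hnorm ?X (f w) \<le> K * hnorm ?Y w"
    using homogeneous_continuous_bound[OF hilbert[of g1 0] hilbert[of g0 0] WY _ Ws] by blast
  have "hnorm ?X (P0 x) \<le> K * hnorm ?Y (A (P0 x))" if "x \<in> car ?X" for x
  proof -
    have v: "P0 x \<in> ?V" using that by blast
    then have "A (P0 x) \<in> ?W" using AV by blast
    then show ?thesis using K fA[OF v] by fastforce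
  qed
  then show thesis using AV by (rule that)
qed

text \<open>Pairing with \<open>x\<close> produces the squared norms of \<open>A x\<close> and
  \<open>E x\<close>. These control \<open>x\<close> because \<open>x = p + E x\<close> and
  \<open>p\<close> is bounded through \<open>A x\<close>; in the application
  \<open>p = P0 x\<close>.\<close>

lemma adjoint_sum_coercive:
  assumes A: "adjoint_op (H g0 0) (H g1 0) A A'" and E: "adjoint_op (H g0 0) (H g0 0) E E'"
    and x: "x \<in> car (H g0 0)" "A x \<in> car (H g1 0)" "E x \<in> car (H g0 0)" "p \<in> car (H g0 0)"
    and K: "hnorm (H g0 0) p \<le> K * hnorm (H g1 0) (A x)" and pE: "x = p + E x"
  shows "1 / (2 * (1 + K\<^sup>2)) * (hnorm (H g0 0) x)\<^sup>2 \<le> Re (ip (H g0 0) (A' (A x) + E' (E x)) x)"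
proof -
  let ?X = "H g0 0" and ?Y = "H g1 0"
  interpret X: complex_hilbert smul ?X by (rule hilbert)
  interpret Y: complex_hilbert smul ?Y by (rule hilbert)
  have "A' (A x) \<in> car ?X" "E' (E x) \<in> car ?X"
    using A E x by (auto simp: adjoint_op_def)
  then have "Re (ip ?X (A' (A x) + E' (E x)) x) = Re (ip ?X x (A' (A x))) + Re (ip ?X x (E' (E x)))"
    using x by (simp add: X.ip_add_left X.Re_ip_commute[of x])
  also have "\<dots> = (hnorm ?Y (A x))\<^sup>2 + (hnorm ?X (E x))\<^sup>2"
    using A E x by (simp add: adjoint_op_def X.hnorm_power2 Y.hnorm_power2)
  finally have eq: "Re (ip ?X (A' (A x) + E' (E x)) x) = (hnorm ?Y (A x))\<^sup>2 + (hnorm ?X (E x))\<^sup>2" .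
  let ?a = "hnorm ?Y (A x)" and ?e = "hnorm ?X (E x)"
  have "hnorm ?X x \<le> K * ?a + ?e"
    using X.hnorm_triangle[OF x(4,3)] K pE by simp
  then have "(hnorm ?X x)\<^sup>2 \<le> (K * ?a + ?e)\<^sup>2"
    using X.hnorm_nonneg[OF x(1)] by (intro power_mono) auto
  also have "\<dots> \<le> 2 * (1 + K\<^sup>2) * (?a\<^sup>2 + ?e\<^sup>2)"
  proof -
    \<comment> \<open>Writing the difference as a sum of squares works for either sign of
      \<open>K\<close>.\<close>
    have "2 * (1 + K\<^sup>2) * (?a\<^sup>2 + ?e\<^sup>2) - (K * ?a + ?e)\<^sup>2 = (K * ?a - ?e)\<^sup>2 + 2 * ?a\<^sup>2 + 2 * (K * ?e)\<^sup>2"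
      by (simp add: power2_eq_square algebra_simps)
    also have "\<dots> \<ge> 0" by simp
    finally show ?thesis by linarith
  qed
  finally have "(hnorm ?X x)\<^sup>2 \<le> 2 * (1 + K\<^sup>2) * (?a\<^sup>2 + ?e\<^sup>2)" .
  moreover have "2 * (1 + K\<^sup>2) > 0" by (simp add: add_pos_nonneg)
  ultimately show ?thesis unfolding eq by (simp add: divide_le_eq mult.commute)
qed

end


section \<open>Spectral invariance\<close>

theorem theorem3p9:
  fixes smul :: "complex \<Rightarrow> 'v::ab_group_add \<Rightarrow> 'v"
    and H :: "'g \<Rightarrow> nat \<Rightarrow> 'v hspace"
    and G :: "('g \<times> 'g) set"
    and L :: "int \<Rightarrow> 'g \<times> 'g \<Rightarrow> ('v \<Rightarrow> 'v) set"
  assumes "operator_classes smul H G L"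
    and "fredholm_property smul H G L"
    and "star_closed H G L"
    and "\<And>g0 g1 R0 R1 T.
      \<lbrakk>(g0, g1) \<in> G; R0 \<in> smoothing L (g0, g0); R1 \<in> smoothing L (g1, g1);
        bounded_op smul (H g0 0) (H g1 0) T\<rbrakk> \<Longrightarrow>
      R1 \<circ> T \<circ> R0 \<in> smoothing L (g0, g1)"
  shows "\<forall>g0 g1 P0 P1. (g0, g1) \<in> G \<longrightarrow> is_projection H L g0 P0 \<longrightarrow> is_projection H L g1 P1 \<longrightarrow>
    spectrally_invariant H L g0 g1 P0 P1"
  unfolding spectrally_invariant_def
proof (intro allI impI ballI)
  interpret operator_classes smul H G L by fact
  fix g0 g1 P0 P1 A
  assume g: "(g0, g1) \<in> G" and P0: "is_projection H L g0 P0" and P1: "is_projection H L g1 P1"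
    and AT: "A \<in> toeplitz H L 0 g0 g1 P0 P1"
    and homeo: "homeomorphic_map (range_top H 0 g0 P0) (range_top H 0 g1 P1) A"
  let ?X = "H g0 0" and ?Y = "H g1 0"
  interpret X: complex_hilbert smul ?X by (rule hilbert)
  interpret Y: complex_hilbert smul ?Y by (rule hilbert)
  have g00: "(g0, g0) \<in> G" and g11: "(g1, g1) \<in> G" and g10: "(g1, g0) \<in> G"
    using G_left[OF g] G_right[OF g] G_swap[OF g] .
  have A: "A \<in> L 0 (g0, g1)" and P1A: "\<And>x. x \<in> car ?X \<Longrightarrow> P1 (A x) = A x"
    and AE: "\<And>x. x \<in> car ?X \<Longrightarrow> A (x - P0 x) = 0"
    using AT by (auto simp: toeplitz_def)
  have P0L: "P0 \<in> L 0 (g0, g0)" and P1L: "P1 \<in> L 0 (g1, g1)"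
    and P0P0: "\<And>x. x \<in> car ?X \<Longrightarrow> P0 (P0 x) = P0 x"
    and P1P1: "\<And>y. y \<in> car ?Y \<Longrightarrow> P1 (P1 y) = P1 y"
    using P0 P1 by (auto simp: is_projection_def)
  note P0X = L_car[OF g00 P0L] and P1Y = L_car[OF g11 P1L] and AY = L_car[OF g A]
  have AP0: "A (P0 x) = A x" if "x \<in> car ?X" for x
    using AE[OF that] X.linear_op_diff[OF L_linear[OF g _ A] that P0X[OF that]] by simp
  \<comment> \<open>\<open>A\<close> vanishes on the range of \<open>E\<close>, so the adjoint of
    \<open>A\<close> composed with \<open>A\<close> degenerates there; the \<open>E\<close> term in
    \<open>S\<close> restores coercivity.\<close>
  define E where "E x = x - P0 x" for x
  have E: "E \<in> L 0 (g0, g0)"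
    unfolding E_def using L_diff[OF g00 L_id[OF g00] P0L] .
  note EX = L_car[OF g00 E]
  obtain A' where A': "A' \<in> L 0 (g1, g0)" "adjoint_op ?X ?Y A A'"
    using \<open>star_closed H G L\<close> g A unfolding star_closed_def by blast
  obtain E' where E': "E' \<in> L 0 (g0, g0)" "adjoint_op ?X ?X E E'"
    using \<open>star_closed H G L\<close> g00 E unfolding star_closed_def by blast
  obtain K where K:
    "\<And>x. x \<in> car ?X \<Longrightarrow> hnorm ?X (P0 x) \<le> K * hnorm ?Y (A (P0 x))"
    and range: "A ` P0 ` car ?X = P1 ` car ?Y"
    using homeomorphic_lower_bound[OF g A P0 P1 homeo] by blast
  define S where "S x = A' (A x) + E' (E x)" for x
  have S: "S \<in> L 0 (g0, g0)"
    unfolding S_def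
    using L_add[OF g00 _ L_comp0[OF g g10 A'(1) A] L_comp0[OF g00 g00 E'(1) E]] by simp
  have "1 / (2 * (1 + K\<^sup>2)) * (hnorm ?X x)\<^sup>2 \<le> Re (ip ?X (S x) x)" if x: "x \<in> car ?X" for x
    unfolding S_def
    using adjoint_sum_coercive[OF A'(2) E'(2) x AY[OF x] EX[OF x] P0X[OF x]]
      K[OF x] AP0[OF x] by (simp add: E_def)
  moreover have "1 / (2 * (1 + K\<^sup>2)) > 0" by (simp add: add_pos_nonneg)
  ultimately obtain T where T: "T \<in> L 0 (g0, g0)"
    and TS: "\<And>x. x \<in> car ?X \<Longrightarrow> T (S x) = x"
    using coercive_inverse[OF assms(2) assms(4)[OF g00] g00 S] by blast
  \<comment> \<open>The outer \<open>P0\<close> and the inner \<open>P1\<close> force the two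
    Toeplitz conditions on \<open>B\<close>.\<close>
  define B where "B y = P0 (T (A' (P1 y)))" for y
  have BL: "B \<in> L 0 (g1, g0)"
    unfolding B_def
    using L_comp0[OF g10 g00 P0L L_comp0[OF g10 g00 T L_comp0[OF g11 g10 A'(1) P1L]]] .
  have BA: "B (A x) = P0 x" if x: "x \<in> car ?X" for x
  proof -
    \<comment> \<open>\<open>E\<close> annihilates the range of \<open>P0\<close>, so only the
      \<open>A\<close> term of \<open>S\<close> survives.\<close>
    have "S (P0 x) = A' (A x)"
      using x X.linear_op_zero[OF L_linear[OF g00 _ E'(1)]] by (simp add: S_def E_def P0P0 AP0)
    then show ?thesis
      using TS[OF P0X[OF x]] x by (simp add: B_def P1A P0P0)
  qed
  have BP1: "B (P1 y) = B y" if "y \<in> car ?Y" for y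
    using that by (simp add: B_def P1P1)
  have "A (B y) = P1 y" if y: "y \<in> car ?Y" for y
  proof -
    \<comment> \<open>The right inverse property follows from the left one, because \<open>A\<close>
      maps the range of \<open>P0\<close> onto that of \<open>P1\<close>.\<close>
    obtain x where x: "x \<in> car ?X" "P1 y = A (P0 x)" using range y by blast
    then have "B y = P0 x"
      using BA[OF P0X[OF x(1)]] BP1[OF y] by (simp add: P0P0)
    then show ?thesis using x by simp
  qed
  moreover have "B \<in> toeplitz H L 0 g1 g0 P1 P0"
  proof -
    have "B y - P0 (B y) = 0" if y: "y \<in> car ?Y" for y
      using P0P0[OF L_car[OF g00 T L_car[OF g10 A'(1) P1Y[OF y]]]] by (simp add: B_def)
    moreover have "B (y - P1 y) = 0" if y: "y \<in> car ?Y" for y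
      using Y.linear_op_diff[OF L_linear[OF g10 _ BL] y P1Y[OF y]] BP1[OF y] by simp
    ultimately show ?thesis using BL by (simp add: toeplitz_def)
  qed
  ultimately show "\<exists>B\<in>toeplitz H L 0 g1 g0 P1 P0.
      (\<forall>x\<in>car ?X. B (A x) = P0 x) \<and> (\<forall>y\<in>car ?Y. A (B y) = P1 y)"
    using BA by blast
qed

end
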